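(* Let $(R,V)$ be a generalized root system, let $S$ be a base of $R$, and let $I \subset S$. Put $V_I = \operatorname{span} I$, let $V/I := V_I^{\perp}$ be the orthogonal complement of $V_I$ in $V$ (with the induced Euclidean structure), let $\pi_I : V \to V_I^\perp$ be the orthogonal projection, and put $R/I := \pi_I(R) \subset V/I$ and $S/I := \pi_I(S)\setminus\{0\}$. Then $(R/I, V/I)$ is a generalized root system with a base $S/I$.
   Context: A generalized root system (GRS) is a pair $(R,V)$ where $V$ is a finite-dimensional Euclidean space and $R\subset V$ is a non-empty finite set such that: (i) $V=\operatorname{span} R$; (ii) for all $\alpha,\beta\in R$: if $\langle\alpha,\beta\rangle<0$ then $\alpha+\beta\in R$; if $\langle\alpha,\beta\rangle>0$ then $\alpha-\beta\in R$; if $\langle\alpha,\beta\rangle=0$ then $\alpha+\beta\in R$ if and only if $\alpha-\beta\in R$. (It follows that $0\in R$ and $R=-R$.) A base of $R$ is a subset $S\subset R$ which is a basis of $V$ and such that every $\beta\in R$ can be written $\beta=\sum_{\alpha\in S}m_\alpha\alpha$ with all $m_\alpha\in\mathbb{Z}_{\ge0}$ or all $m_\alpha\in\mathbb{Z}_{\le0}$. *)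

theory Defs
  imports "HOL-Analysis.Analysis"
begin

(* A finite-dimensional Euclidean space V is represented as a subspace of an arbitrary ambient
   type of class euclidean_space, so that V, its subspaces and orthogonal complements in V
   are objects of the same kind. In particular V = {0} is allowed. *)

definition generalized_root_system :: "'a::euclidean_space set \<Rightarrow> 'a set \<Rightarrow> bool" where
  "generalized_root_system R V \<longleftrightarrow>
     subspace V \<and> R \<subseteq> V \<and> R \<noteq> {} \<and> finite R \<and> V = span R \<and>
     (\<forall>\<alpha>\<in>R. \<forall>\<beta>\<in>R.
        (\<alpha> \<bullet> \<beta> < 0 \<longrightarrow> \<alpha> + \<beta> \<in> R) \<and>
        (\<alpha> \<bullet> \<beta> > 0 \<longrightarrow> \<alpha> - \<beta> \<in> R) \<and>
        (\<alpha> \<bullet> \<beta> = 0 \<longrightarrow> (\<alpha> + \<beta> \<in> R \<longleftrightarrow> \<alpha> - \<beta> \<in> R)))"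

(* The sum ranges over a finite set, because an independent set in a Euclidean space is finite. *)
definition is_base :: "'a::euclidean_space set \<Rightarrow> 'a set \<Rightarrow> 'a set \<Rightarrow> bool" where
  "is_base S R V \<longleftrightarrow>
     S \<subseteq> R \<and> independent S \<and> span S = V \<and>
     (\<forall>\<beta>\<in>R. \<exists>m :: 'a \<Rightarrow> int.
        \<beta> = (\<Sum>\<alpha>\<in>S. of_int (m \<alpha>) *\<^sub>R \<alpha>) \<and>
        ((\<forall>\<alpha>\<in>S. m \<alpha> \<ge> 0) \<or> (\<forall>\<alpha>\<in>S. m \<alpha> \<le> 0)))"

definition orth_proj :: "'a::euclidean_space set \<Rightarrow> 'a \<Rightarrow> 'a" where
  "orth_proj W x = (THE y. y \<in> W \<and> x - y \<in> orthogonal_comp W)"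

lemma orth_proj_ex1:
  fixes W :: "'a::euclidean_space set"
  assumes "subspace W"
  shows "\<exists>!y. y \<in> W \<and> x - y \<in> orthogonal_comp W"
proof -
  have sW: "span W = W" using assms by (simp add: span_eq_iff)
  obtain y z where y: "y \<in> span W" and z: "\<And>w. w \<in> span W \<Longrightarrow> orthogonal z w" and x: "x = y + z"
    using orthogonal_subspace_decomp_exists[of W x] by metis
  show ?thesis
  proof (rule ex1I[of _ y])
    show "y \<in> W \<and> x - y \<in> orthogonal_comp W"
      using y z x sW by (auto simp: orthogonal_comp_def orthogonal_commute)
    fix y' assume y': "y' \<in> W \<and> x - y' \<in> orthogonal_comp W"
    have "x - y \<in> orthogonal_comp W"
      using z x sW by (auto simp: orthogonal_comp_def orthogonal_commute)
    then have "(x - y) - (x - y') \<in> orthogonal_comp W"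
      using y' subspace_orthogonal_comp subspace_diff by blast
    moreover have "y' - y \<in> W" using y y' sW assms subspace_diff by metis
    ultimately show "y' = y" by (auto simp: orthogonal_comp_def orthogonal_def)
  qed
qed

definition quot_space :: "'a::euclidean_space set \<Rightarrow> 'a set \<Rightarrow> 'a set" where
  "quot_space V I = V \<inter> orthogonal_comp (span I)"

definition quot_proj :: "'a::euclidean_space set \<Rightarrow> 'a set \<Rightarrow> 'a \<Rightarrow> 'a" where
  "quot_proj V I = orth_proj (quot_space V I)"

definition quot_roots :: "'a::euclidean_space set \<Rightarrow> 'a set \<Rightarrow> 'a set \<Rightarrow> 'a set" where
  "quot_roots R V I = quot_proj V I ` R"

definition quot_base :: "'a::euclidean_space set \<Rightarrow> 'a set \<Rightarrow> 'a set \<Rightarrow> 'a set" where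
  "quot_base S V I = quot_proj V I ` S - {0}"

end

theory Submission
  imports Defs
begin

text \<open>Write \<open>\<pi>\<close> for the projection. That \<open>\<pi>(S) - {0}\<close> is a base of \<open>\<pi>(R)\<close> is linear
  algebra: \<open>\<pi>\<close> has kernel \<open>span I\<close> on \<open>V\<close>, so it kills \<open>I\<close>, is injective on
  \<open>span (S - I)\<close>, and carries the coordinates of \<open>\<beta>\<close> at \<open>S - I\<close> to coordinates of \<open>\<pi> \<beta>\<close>.

  For the axioms of a generalized root system one has to lift sums and differences of projected
  roots, and the difficulty is that \<open>\<alpha> \<bullet> \<beta>\<close> differs from \<open>\<pi> \<alpha> \<bullet> \<pi> \<beta>\<close> by the inner product of
  the components in \<open>span I\<close>, which depends on the chosen roots. The key fact
  (\<open>fibres_balanced\<close>) is that this error term cannot be one-sided: if it is negative for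
  some pair of roots in the two fibres of \<open>\<pi>\<close>, it is positive for another pair in the same
  fibres. Replacing \<open>\<beta>\<close> by \<open>-\<beta>\<close> exchanges the two signs.

  If \<open>\<pi> \<alpha> \<bullet> \<pi> \<beta> > 0\<close>, balance thus allows a choice of representatives with
  \<open>\<alpha> \<bullet> \<beta> > 0\<close>, so that \<open>\<alpha> - \<beta>\<close> is a root. Now let \<open>\<pi> \<alpha> \<bullet> \<pi> \<beta> = 0\<close>, where
  \<open>\<pi> \<alpha> + \<pi> \<beta> = \<pi> \<gamma>\<close> and \<open>\<pi> \<alpha> \<noteq> 0\<close>. As \<open>\<pi> \<gamma> \<bullet> \<pi> \<alpha> > 0\<close>, representatives can be chosen
  with \<open>\<beta> = \<gamma> - \<alpha>\<close> a root. If \<open>\<alpha> \<bullet> \<beta> \<ge> 0\<close>, then \<open>\<alpha> - \<beta>\<close> is a root by the axioms for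
  \<open>R\<close>; if \<open>\<alpha> \<bullet> \<beta> < 0\<close>, balance supplies another pair with positive inner product, whose
  difference is a root.

  Balance itself comes from roots that are dominant for suitable subsets of \<open>I\<close>
  (\<open>ex_nontrivial_dominant_root\<close>), combined with the fact that distinct elements of a base
  pair nonpositively, so that dominant vectors have nonnegative
  coefficients (\<open>dominant_imp_coeffs_nonneg\<close>).\<close>

section \<open>Generalized root systems\<close>

lemma grs_add_mem:
  assumes "generalized_root_system R V" "\<alpha> \<in> R" "\<beta> \<in> R" "\<alpha> \<bullet> \<beta> < 0"
  shows "\<alpha> + \<beta> \<in> R"
  using assms unfolding generalized_root_system_def by blast

lemma grs_diff_mem:
  assumes "generalized_root_system R V" "\<alpha> \<in> R" "\<beta> \<in> R" "\<alpha> \<bullet> \<beta> > 0"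
  shows "\<alpha> - \<beta> \<in> R"
  using assms unfolding generalized_root_system_def by blast

lemma grs_orthogonal_mem_iff:
  assumes "generalized_root_system R V" "\<alpha> \<in> R" "\<beta> \<in> R" "\<alpha> \<bullet> \<beta> = 0"
  shows "\<alpha> + \<beta> \<in> R \<longleftrightarrow> \<alpha> - \<beta> \<in> R"
  using assms unfolding generalized_root_system_def by blast

lemma grs_zero_mem:
  assumes "generalized_root_system R V"
  shows "0 \<in> R"
proof -
  obtain \<alpha> where \<alpha>: "\<alpha> \<in> R"
    using assms unfolding generalized_root_system_def by blast
  show ?thesis
  proof (cases "\<alpha> = 0")
    case False
    then show ?thesis using grs_diff_mem[OF assms \<alpha> \<alpha>] by simp
  qed (use \<alpha> in simp)
qed

lemma grs_uminus_mem:
  assumes "generalized_root_system R V" "\<alpha> \<in> R"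
  shows "- \<alpha> \<in> R"
  using grs_orthogonal_mem_iff[OF assms(1) grs_zero_mem[OF assms(1)] assms(2)] assms(2) by simp

lemma base_subset:
  assumes "is_base S R V"
  shows "S \<subseteq> R"
  using assms by (simp add: is_base_def)

lemma base_independent:
  assumes "is_base S R V"
  shows "independent S"
  using assms by (simp add: is_base_def)

lemma base_finite:
  assumes "is_base S R V"
  shows "finite S"
  using assms by (simp add: is_base_def independent_imp_finite)

lemma base_coords:
  fixes S :: "'a::euclidean_space set"
  assumes "is_base S R V" "\<beta> \<in> R"
  obtains m :: "'a \<Rightarrow> int" where "\<beta> = (\<Sum>\<alpha>\<in>S. of_int (m \<alpha>) *\<^sub>R \<alpha>)"
    and "(\<forall>\<alpha>\<in>S. m \<alpha> \<ge> 0) \<or> (\<forall>\<alpha>\<in>S. m \<alpha> \<le> 0)"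
proof -
  have "\<forall>\<beta>\<in>R. \<exists>m :: 'a \<Rightarrow> int. \<beta> = (\<Sum>\<alpha>\<in>S. of_int (m \<alpha>) *\<^sub>R \<alpha>) \<and>
      ((\<forall>\<alpha>\<in>S. m \<alpha> \<ge> 0) \<or> (\<forall>\<alpha>\<in>S. m \<alpha> \<le> 0))"
    using assms(1) by (simp add: is_base_def)
  from bspec[OF this assms(2)] show thesis using that by blast
qed

text \<open>A positive inner product would make \<open>i - j\<close> a root, whose coordinates have both signs.\<close>

lemma base_obtuse:
  assumes grs: "generalized_root_system R V" and base: "is_base S R V"
    and "i \<in> S" "j \<in> S" "i \<noteq> j"
  shows "i \<bullet> j \<le> 0"
proof (rule ccontr)
  assume "\<not> i \<bullet> j \<le> 0"
  then have "i - j \<in> R"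
    using grs_diff_mem[OF grs, of i j] subsetD[OF base_subset[OF base]] assms(3,4) by auto
  from base_coords[OF base this] obtain m :: "'a \<Rightarrow> int" where m: "i - j = (\<Sum>\<alpha>\<in>S. of_int (m \<alpha>) *\<^sub>R \<alpha>)"
    and sgn: "(\<forall>\<alpha>\<in>S. m \<alpha> \<ge> 0) \<or> (\<forall>\<alpha>\<in>S. m \<alpha> \<le> 0)"
    by blast
  have fin: "finite S" by (rule base_finite[OF base])
  define u where "u \<alpha> = of_int (m \<alpha>) - (if \<alpha> = i then 1 else 0) + (if \<alpha> = j then 1 else (0::real))"
    for \<alpha>
  have delta: "(\<Sum>\<alpha>\<in>S. (if \<alpha> = k then 1 else (0::real)) *\<^sub>R \<alpha>) = k" if "k \<in> S" for k
  proof -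
    have "(\<Sum>\<alpha>\<in>S. (if \<alpha> = k then 1 else (0::real)) *\<^sub>R \<alpha>) = (\<Sum>\<alpha>\<in>S. if \<alpha> = k then \<alpha> else 0)"
      by (intro sum.cong) auto
    then show ?thesis using fin that by simp
  qed
  have "(\<Sum>\<alpha>\<in>S. u \<alpha> *\<^sub>R \<alpha>) = (i - j) - i + j"
    unfolding u_def scaleR_add_left scaleR_diff_left sum.distrib sum_subtractf
    by (simp only: delta[OF \<open>i \<in> S\<close>] delta[OF \<open>j \<in> S\<close>] flip: m)
  then have "u i = 0" "u j = 0"
    using independentD[OF base_independent[OF base] fin, of u] assms by simp_all
  then have "m i = 1" "m j = -1"
    using \<open>i \<noteq> j\<close> by (auto simp: u_def)
  then show False using sgn assms by force
qed

section \<open>Dominant vectors and dominant roots\<close>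

text \<open>The inverse Gram matrix of an obtuse basis has nonnegative entries. If \<open>n\<close> denotes the
  part of \<open>v\<close> with negative coefficients, then \<open>v \<bullet> n \<le> 0\<close> by dominance, whereas
  obtuseness gives \<open>v \<bullet> n \<ge> n \<bullet> n\<close>; hence \<open>n = 0\<close>.\<close>

lemma dominant_imp_coeffs_nonneg:
  fixes T :: "'a::euclidean_space set"
  assumes indep: "independent T"
    and obtuse: "\<And>s t. s \<in> T \<Longrightarrow> t \<in> T \<Longrightarrow> s \<noteq> t \<Longrightarrow> s \<bullet> t \<le> 0"
    and v: "v = (\<Sum>t\<in>T. c t *\<^sub>R t)"
    and dominant: "\<And>t. t \<in> T \<Longrightarrow> v \<bullet> t \<ge> 0"
    and "t \<in> T"
  shows "c t \<ge> 0"
proof (rule ccontr)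
  assume neg: "\<not> c t \<ge> 0"
  have fin: "finite T" using indep by (rule independent_imp_finite)
  define N where "N = {t\<in>T. c t < 0}"
  define n where "n = (\<Sum>t\<in>N. c t *\<^sub>R t)"
  define p where "p = (\<Sum>t\<in>T - N. c t *\<^sub>R t)"
  have N: "N \<subseteq> T" "finite N" using fin by (auto simp: N_def)
  have v_eq: "v = p + n"
    unfolding v p_def n_def using sum.subset_diff[OF N(1) fin] by blast
  have "v \<bullet> n \<le> 0"
    unfolding n_def inner_sum_right
    by (rule sum_nonpos) (use dominant in \<open>auto simp: N_def mult_nonpos_nonneg\<close>)
  moreover have "p \<bullet> n \<ge> 0"
    unfolding p_def n_def inner_sum_right inner_sum_left
  proof (intro sum_nonneg)
    fix s t assume st: "s \<in> N" "t \<in> T - N"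
    then have "t \<bullet> s \<le> 0" "c s \<le> 0" "c t \<ge> 0" using obtuse[of t s] by (auto simp: N_def)
    then show "c t *\<^sub>R t \<bullet> c s *\<^sub>R s \<ge> 0"
      using mult_nonpos_nonpos[of "c s" "c t * (t \<bullet> s)"] by (simp add: mult_nonneg_nonpos)
  qed
  ultimately have "n \<bullet> n \<le> 0" by (simp add: v_eq inner_add_left)
  then have "n = 0" by (metis inner_ge_zero inner_eq_zero_iff order_antisym)
  then have "c t = 0"
    using independentD[OF indep N(2,1), of c t] neg \<open>t \<in> T\<close> by (simp add: n_def N_def)
  with neg show False by simp
qed

text \<open>Among the roots congruent to \<open>\<alpha>\<close> modulo the span of \<open>J\<close> and not orthogonal to
  \<open>J\<close>, take \<open>\<beta>\<close> of maximal height. If \<open>\<beta> \<bullet> j < 0\<close> then the root \<open>\<beta> + j\<close> is higher, hence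
  orthogonal to \<open>J\<close>. As \<open>(\<beta> + j) - j\<close> is a root, the axiom for orthogonal pairs makes
  \<open>\<beta> + 2j\<close> a root too; it is higher than \<open>\<beta>\<close> and pairs with \<open>j\<close> to \<open>j \<bullet> j > 0\<close>, which
  contradicts maximality. Excluding orthogonal roots from the competition is what makes the
  dominant root found here nontrivial.\<close>

lemma ex_nontrivial_dominant_root:
  assumes grs: "generalized_root_system R V"
    and J: "J \<subseteq> R" "independent J"
    and \<alpha>: "\<alpha> \<in> R" "\<exists>j\<in>J. \<alpha> \<bullet> j \<noteq> 0"
  shows "\<exists>\<beta>\<in>R. \<beta> - \<alpha> \<in> span J \<and> (\<forall>j\<in>J. \<beta> \<bullet> j \<ge> 0) \<and> (\<exists>j\<in>J. \<beta> \<bullet> j > 0)"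
proof -
  \<comment> \<open>The height: on the span of \<open>J\<close> it is the sum of the coordinates. Only its differences
    within one coset of this span are used, so any linear extension will do.\<close>
  obtain h :: "'a \<Rightarrow> real" where h: "linear h" "\<And>j. j \<in> J \<Longrightarrow> h j = 1"
    using linear_independent_extend[OF J(2), of "\<lambda>_. 1"] by metis
  define F where "F = {\<beta>\<in>R. \<beta> - \<alpha> \<in> span J \<and> (\<exists>j\<in>J. \<beta> \<bullet> j \<noteq> 0)}"
  have "finite F" using grs by (simp add: F_def generalized_root_system_def)
  moreover have "\<alpha> \<in> F" using \<alpha> by (simp add: F_def span_zero)
  ultimately obtain \<beta> where \<beta>: "\<beta> \<in> F" "\<And>\<gamma>. \<gamma> \<in> F \<Longrightarrow> h \<gamma> \<le> h \<beta>"
    using finite_imageI[of F h] Max_in[of "h ` F"] Max_ge[of "h ` F"]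
    by (metis empty_iff imageE image_eqI image_is_empty)
  have \<beta>R: "\<beta> \<in> R" "\<beta> - \<alpha> \<in> span J" "\<exists>j\<in>J. \<beta> \<bullet> j \<noteq> 0" using \<beta>(1) by (auto simp: F_def)
  have dominant: "\<beta> \<bullet> j \<ge> 0" if "j \<in> J" for j
  proof (rule ccontr)
    assume "\<not> \<beta> \<bullet> j \<ge> 0"
    then have R1: "\<beta> + j \<in> R" using grs_add_mem[OF grs \<beta>R(1), of j] J(1) that by auto
    have s1: "\<beta> + j - \<alpha> \<in> span J"
      using span_add[OF \<beta>R(2) span_base[OF that]] by (simp add: algebra_simps)
    have "\<beta> + j \<notin> F" using \<beta>(2)[of "\<beta> + j"] h that by (auto simp: linear_add)
    then have orth: "(\<beta> + j) \<bullet> j = 0" using R1 s1 that by (auto simp: F_def)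
    have "\<beta> + j + j \<in> R"
      using grs_orthogonal_mem_iff[OF grs R1 _ orth] \<beta>R(1) J(1) that by auto
    moreover have "\<beta> + j + j - \<alpha> \<in> span J"
      using span_add[OF s1 span_base[OF that]] by (simp add: algebra_simps)
    moreover have "j \<noteq> 0" using J(2) that dependent_zero by blast
    then have "(\<beta> + j + j) \<bullet> j \<noteq> 0" using orth by (simp add: inner_add_left)
    ultimately have "\<beta> + j + j \<in> F" using that by (auto simp: F_def)
    then show False using \<beta>(2)[of "\<beta> + j + j"] h that by (auto simp: linear_add)
  qed
  then show ?thesis using \<beta>R by (metis less_eq_real_def)
qed

section \<open>Balanced fibres\<close>

text \<open>Here \<open>x\<close> and \<open>y\<close> stand for the projections of \<open>\<alpha>\<close> and \<open>\<beta>\<close>, and the fibre of a root is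
  its class in \<open>R\<close> modulo \<open>span I\<close>.

  Let \<open>T\<close> consist of the elements of \<open>I\<close> to which the fibre of \<open>\<alpha>\<close> is not orthogonal.
  If a root \<open>\<gamma>\<close> of this fibre is not orthogonal to \<open>t \<in> T\<close>, then \<open>\<gamma> + t\<close> or \<open>\<gamma> - t\<close> is in the
  fibre as well; both it and \<open>\<gamma>\<close> are orthogonal to \<open>I - T\<close>, and hence so is \<open>t\<close>. Therefore the
  \<open>I\<close>-components of the fibre lie in \<open>span T\<close>, and \<open>\<beta>\<close> is not orthogonal to \<open>T\<close>. So the fibre of
  \<open>\<beta>\<close> contains a nontrivial \<open>T\<close>-dominant root \<open>\<beta>'\<close>, whose component in \<open>span T\<close> is a
  combination of a nonempty \<open>J \<subseteq> T\<close> with positive coefficients. By the choice of \<open>T\<close>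
  the fibre of \<open>\<alpha>\<close> is not orthogonal to \<open>J\<close>; a nontrivial \<open>J\<close>-dominant root in it pairs
  positively with this component.\<close>

lemma fibres_balanced:
  assumes grs: "generalized_root_system R V"
    and I: "I \<subseteq> R" "independent I"
    and obtuse: "\<And>i j. i \<in> I \<Longrightarrow> j \<in> I \<Longrightarrow> i \<noteq> j \<Longrightarrow> i \<bullet> j \<le> 0"
    and \<alpha>: "\<alpha> \<in> R" "\<alpha> - x \<in> span I" and x: "\<And>i. i \<in> I \<Longrightarrow> x \<bullet> i = 0"
    and \<beta>: "\<beta> \<in> R" "\<beta> - y \<in> span I" and y: "\<And>i. i \<in> I \<Longrightarrow> y \<bullet> i = 0"
    and neg: "(\<alpha> - x) \<bullet> (\<beta> - y) < 0"
  shows "\<exists>\<alpha>'\<in>R. \<exists>\<beta>'\<in>R. \<alpha>' - x \<in> span I \<and> \<beta>' - y \<in> span I \<and> (\<alpha>' - x) \<bullet> (\<beta>' - y) > 0"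
proof -
  define A where "A = {\<gamma>\<in>R. \<gamma> - x \<in> span I}"
  define T where "T = {i\<in>I. \<exists>\<gamma>\<in>A. \<gamma> \<bullet> i \<noteq> 0}"
  have T: "T \<subseteq> I" by (auto simp: T_def)
  have indep_T: "independent T" using independent_mono[OF I(2) T] .
  have span_T: "span T \<subseteq> span I" using span_mono[OF T] .
  have orth_span: "u \<bullet> w = 0" if "w \<in> span X" "\<And>i. i \<in> X \<Longrightarrow> u \<bullet> i = 0" for u w :: 'a and X
    using orthogonal_to_span[OF that(1), of u] that(2) by (simp add: orthogonal_def)
  have A_perp: "\<gamma> \<bullet> u = 0" if "\<gamma> \<in> A" "u \<in> I - T" for \<gamma> u
    using that by (auto simp: T_def)
  have perp: "t \<bullet> u = 0" if t: "t \<in> T" and u: "u \<in> I - T" for t u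
  proof -
    obtain \<gamma> where \<gamma>: "\<gamma> \<in> A" "\<gamma> \<bullet> t \<noteq> 0" using t by (auto simp: T_def)
    have tI: "t \<in> span I" and tR: "t \<in> R" using t T I by (auto intro: span_base)
    have "\<gamma> + t \<in> R \<or> \<gamma> - t \<in> R"
      using grs_add_mem[OF grs _ tR, of \<gamma>] grs_diff_mem[OF grs _ tR, of \<gamma>] \<gamma>
      by (auto simp: A_def neq_iff)
    moreover have "\<gamma> + t - x \<in> span I" "\<gamma> - t - x \<in> span I"
      using span_add[OF _ tI, of "\<gamma> - x"] span_diff[OF _ tI, of "\<gamma> - x"] \<gamma>(1)
      by (auto simp: A_def algebra_simps)
    ultimately have "\<gamma> + t \<in> A \<or> \<gamma> - t \<in> A" by (auto simp: A_def)
    then show ?thesis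
      using A_perp[OF _ u, of "\<gamma> + t"] A_perp[OF _ u, of "\<gamma> - t"] A_perp[OF \<gamma>(1) u]
      by (auto simp: inner_add_left inner_diff_left)
  qed
  have A_span: "\<gamma> - x \<in> span T" if \<gamma>: "\<gamma> \<in> A" for \<gamma>
  proof -
    have "\<gamma> - x \<in> span (T \<union> (I - T))" using \<gamma> T by (simp add: A_def Un_absorb1)
    then obtain p q where pq: "\<gamma> - x = p + q" "p \<in> span T" "q \<in> span (I - T)"
      unfolding span_Un by blast
    have "q \<bullet> u = 0" if u: "u \<in> I - T" for u
    proof -
      have "u \<bullet> p = 0" by (rule orth_span[OF pq(2)]) (use perp u in \<open>auto simp: inner_commute\<close>)
      moreover have "(\<gamma> - x) \<bullet> u = 0" using A_perp[OF \<gamma> u] x u by (simp add: inner_diff_left)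
      ultimately show ?thesis by (simp add: pq(1) inner_add_left inner_add_right inner_commute)
    qed
    then have "q \<bullet> q = 0" by (rule orth_span[OF pq(3)])
    then show ?thesis using pq by simp
  qed
  have "\<exists>t\<in>T. \<beta> \<bullet> t \<noteq> 0"
  proof (rule ccontr)
    assume "\<not> ?thesis"
    then have perp_T: "(\<beta> - y) \<bullet> t = 0" if "t \<in> T" for t
      using that y[of t] T by (auto simp: inner_diff_left)
    have "\<alpha> - x \<in> span T" using A_span \<alpha> by (simp add: A_def)
    then have "(\<beta> - y) \<bullet> (\<alpha> - x) = 0" using perp_T by (rule orth_span)
    with neg show False by (simp add: inner_commute)
  qed
  then obtain \<beta>' where \<beta>': "\<beta>' \<in> R" "\<beta>' - \<beta> \<in> span T" "\<And>t. t \<in> T \<Longrightarrow> \<beta>' \<bullet> t \<ge> 0"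
      "\<exists>t\<in>T. \<beta>' \<bullet> t > 0"
    using ex_nontrivial_dominant_root[OF grs _ indep_T \<beta>(1)] T I(1) by blast
  have \<beta>'_span: "\<beta>' - y \<in> span I"
    using span_add[OF \<beta>(2) subsetD[OF span_T \<beta>'(2)]] by simp
  obtain w z where w: "w \<in> span T" and z: "\<And>u. u \<in> span T \<Longrightarrow> orthogonal z u" and wz: "\<beta>' = w + z"
    using orthogonal_subspace_decomp_exists[of T \<beta>'] by metis
  have w_inner: "u \<bullet> \<beta>' = u \<bullet> w" if "u \<in> span T" for u
    using z[OF that] by (simp add: wz inner_add_right orthogonal_def inner_commute)
  have finT: "finite T" using indep_T by (rule independent_imp_finite)
  obtain c where c: "w = (\<Sum>t\<in>T. c t *\<^sub>R t)"
    using w unfolding span_finite[OF finT] by blast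
  have c_nonneg: "c t \<ge> 0" if "t \<in> T" for t
  proof (rule dominant_imp_coeffs_nonneg[OF indep_T _ c _ that])
    show "s \<bullet> t \<le> 0" if "s \<in> T" "t \<in> T" "s \<noteq> t" for s t using that T obtuse by blast
    show "w \<bullet> t \<ge> 0" if "t \<in> T" for t
      using \<beta>'(3)[OF that] w_inner[OF span_base[OF that]] by (simp add: inner_commute)
  qed
  define J where "J = {t\<in>T. c t > 0}"
  have J: "J \<subseteq> T" by (auto simp: J_def)
  have w_J: "w = (\<Sum>t\<in>J. c t *\<^sub>R t)"
    unfolding c using finT J c_nonneg
    by (intro sum.mono_neutral_right) (force simp: J_def)+
  have "w \<noteq> 0" using \<beta>'(4) w_inner span_base by (fastforce simp: inner_commute)
  then obtain j where j: "j \<in> J" using w_J by fastforce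
  then obtain \<gamma> where \<gamma>: "\<gamma> \<in> A" "\<gamma> \<bullet> j \<noteq> 0" using J by (auto simp: T_def)
  have "\<exists>\<alpha>'\<in>R. \<alpha>' - \<gamma> \<in> span J \<and> (\<forall>j\<in>J. \<alpha>' \<bullet> j \<ge> 0) \<and> (\<exists>j\<in>J. \<alpha>' \<bullet> j > 0)"
  proof (rule ex_nontrivial_dominant_root[OF grs])
    show "J \<subseteq> R" using J T I(1) by blast
    show "independent J" using independent_mono[OF indep_T J] .
  qed (use \<gamma> j in \<open>auto simp: A_def\<close>)
  then obtain \<alpha>' where \<alpha>': "\<alpha>' \<in> R" "\<alpha>' - \<gamma> \<in> span J" "\<And>j. j \<in> J \<Longrightarrow> \<alpha>' \<bullet> j \<ge> 0"
      "\<exists>j\<in>J. \<alpha>' \<bullet> j > 0"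
    by blast
  have "span J \<subseteq> span I" using J T by (intro span_mono) blast
  then have \<alpha>'_span: "\<alpha>' - x \<in> span I"
    using span_add[of "\<alpha>' - \<gamma>" I "\<gamma> - x"] \<alpha>'(2) \<gamma>(1) by (auto simp: A_def)
  then have \<alpha>'_T: "\<alpha>' - x \<in> span T" using A_span \<alpha>'(1) by (simp add: A_def)
  have "(\<alpha>' - x) \<bullet> (\<beta>' - y) = (\<alpha>' - x) \<bullet> w"
    using w_inner[OF \<alpha>'_T] orth_span[OF \<alpha>'_span y] by (simp add: inner_diff_right inner_commute)
  also have "x \<bullet> w = 0" using orth_span[OF subsetD[OF span_T w] x] .
  then have "(\<alpha>' - x) \<bullet> w = \<alpha>' \<bullet> w" by (simp add: inner_diff_left)
  also have "\<dots> = (\<Sum>t\<in>J. c t * (\<alpha>' \<bullet> t))" by (simp add: w_J inner_sum_right)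
  also have "\<dots> > 0"
  proof -
    obtain k where k: "k \<in> J" "\<alpha>' \<bullet> k > 0" using \<alpha>'(4) by blast
    show ?thesis
      by (rule sum_pos2[OF _ k(1)]) (use finT J k \<alpha>'(3) in \<open>auto simp: J_def intro: finite_subset\<close>)
  qed
  finally show ?thesis using \<alpha>'(1) \<beta>'(1) \<alpha>'_span \<beta>'_span by blast
qed

section \<open>The orthogonal projection along the span of a part of the base\<close>

lemma orth_proj_eqI:
  assumes "subspace W" "y \<in> W" "x - y \<in> orthogonal_comp W"
  shows "orth_proj W x = y"
  unfolding orth_proj_def using orth_proj_ex1[OF assms(1), of x] assms(2,3)
  by (intro the1_equality) auto

lemma orth_proj_props:
  assumes "subspace W"
  shows "orth_proj W x \<in> W" "x - orth_proj W x \<in> orthogonal_comp W"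
  using theI'[OF orth_proj_ex1[OF assms, of x]] unfolding orth_proj_def by auto

lemma linear_orth_proj:
  assumes W: "subspace W"
  shows "linear (orth_proj W)"
proof (rule linearI)
  note [simp] = W subspace_orthogonal_comp orth_proj_props[OF W]
  fix x y and c :: real
  have "x + y - (orth_proj W x + orth_proj W y) = (x - orth_proj W x) + (y - orth_proj W y)"
    by simp
  also have "\<dots> \<in> orthogonal_comp W" by (intro subspace_add) simp_all
  finally show "orth_proj W (x + y) = orth_proj W x + orth_proj W y"
    by (intro orth_proj_eqI subspace_add) simp_all
  have "c *\<^sub>R x - c *\<^sub>R orth_proj W x = c *\<^sub>R (x - orth_proj W x)"
    by (simp add: scaleR_diff_right)
  also have "\<dots> \<in> orthogonal_comp W" by (intro subspace_scale) simp_all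
  finally show "orth_proj W (c *\<^sub>R x) = c *\<^sub>R orth_proj W x"
    by (intro orth_proj_eqI subspace_scale) simp_all
qed

lemma subspace_quot_space: "subspace V \<Longrightarrow> subspace (quot_space V I)"
  unfolding quot_space_def by (intro subspace_inter subspace_orthogonal_comp)

lemma linear_quot_proj: "subspace V \<Longrightarrow> linear (quot_proj V I)"
  unfolding quot_proj_def by (intro linear_orth_proj subspace_quot_space)

lemma quot_proj_mem: "subspace V \<Longrightarrow> quot_proj V I x \<in> quot_space V I"
  unfolding quot_proj_def by (intro orth_proj_props subspace_quot_space)

lemma quot_space_orth:
  "z \<in> quot_space V I \<Longrightarrow> w \<in> span I \<Longrightarrow> z \<bullet> w = 0"
  by (auto simp: quot_space_def orthogonal_comp_def orthogonal_def inner_commute)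

lemma quot_proj_eqI:
  assumes "subspace V" "z \<in> quot_space V I" "x - z \<in> span I"
  shows "quot_proj V I x = z"
  unfolding quot_proj_def using assms(2,3)
  by (intro orth_proj_eqI subspace_quot_space[OF assms(1)])
     (auto simp: orthogonal_comp_def[of "quot_space V I"] orthogonal_def quot_space_orth)

lemma diff_quot_proj_mem_span:
  assumes "subspace V" "I \<subseteq> V" "x \<in> V"
  shows "x - quot_proj V I x \<in> span I"
proof -
  obtain y z where y: "y \<in> span I" and z: "\<And>w. w \<in> span I \<Longrightarrow> orthogonal z w" and x: "x = y + z"
    using orthogonal_subspace_decomp_exists[of I x] by metis
  have "y \<in> V" using y assms(1,2) span_minimal by blast
  then have "x - y \<in> V" using assms subspace_diff by blast
  then have "z \<in> quot_space V I"
    using z x by (auto simp: quot_space_def orthogonal_comp_def orthogonal_commute)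
  then have "quot_proj V I x = z"
    using x y by (intro quot_proj_eqI[OF assms(1)]) auto
  then show ?thesis using x y by simp
qed

lemma quot_proj_image: "subspace V \<Longrightarrow> quot_proj V I ` V = quot_space V I"
proof (intro equalityI subsetI)
  fix z assume V: "subspace V" and z: "z \<in> quot_space V I"
  have "quot_proj V I z = z" using V z by (intro quot_proj_eqI) (auto simp: span_zero)
  moreover have "z \<in> V" using z by (simp add: quot_space_def)
  ultimately show "z \<in> quot_proj V I ` V" by (metis imageI)
qed (auto simp: quot_proj_mem)

lemma quot_proj_eq_zero: "subspace V \<Longrightarrow> x \<in> span I \<Longrightarrow> quot_proj V I x = 0"
  by (rule quot_proj_eqI) (auto simp: subspace_0 subspace_quot_space)

text \<open>The linear projection that keeps the coordinates at \<open>I\<close> both fixes and kills \<open>z\<close>.\<close>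

lemma span_Int_span_Diff:
  fixes S :: "'a::euclidean_space set"
  assumes S: "independent S" and "I \<subseteq> S" and z: "z \<in> span I" "z \<in> span (S - I)"
  shows "z = 0"
proof -
  obtain f :: "'a \<Rightarrow> 'a" where f: "linear f" "\<And>x. x \<in> S \<Longrightarrow> f x = (if x \<in> I then x else 0)"
    using linear_independent_extend[OF S, of "\<lambda>x. if x \<in> I then x else 0"] by metis
  have "f z = z"
    by (rule linear_eq_on_span[OF f(1) linear_ident _ z(1)]) (use f(2) \<open>I \<subseteq> S\<close> in auto)
  moreover have "f z = 0"
    by (rule linear_eq_on_span[OF f(1) linear_zero _ z(2)]) (use f(2) in auto)
  ultimately show ?thesis by simp
qed

section \<open>The quotient\<close>

text \<open>Balance is first restated for the projection, as a comparison of \<open>\<alpha> \<bullet> \<beta>\<close> with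
  \<open>\<pi> \<alpha> \<bullet> \<pi> \<beta>\<close>. Negative products reduce to positive ones, and one implication of the
  axiom for orthogonal pairs reduces to the other, by passing from \<open>\<beta>\<close> to \<open>-\<beta>\<close>.\<close>

lemma quot_is_grs:
  assumes grs: "generalized_root_system R V" and base: "is_base S R V" and "I \<subseteq> S"
  shows "generalized_root_system (quot_roots R V I) (quot_space V I)"
proof -
  let ?p = "quot_proj V I"
  have V: "subspace V" and RV: "R \<subseteq> V" and fin: "finite R" and VR: "V = span R"
    using grs by (auto simp: generalized_root_system_def)
  have IR: "I \<subseteq> R" using base_subset[OF base] \<open>I \<subseteq> S\<close> by blast
  have IV: "I \<subseteq> V" using IR RV by blast
  have indep: "independent I" using independent_mono[OF base_independent[OF base] \<open>I \<subseteq> S\<close>] .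
  have obtuse: "i \<bullet> j \<le> 0" if "i \<in> I" "j \<in> I" "i \<noteq> j" for i j
    using base_obtuse[OF grs base] that \<open>I \<subseteq> S\<close> by blast
  note lin = linear_quot_proj[OF V, of I]
  have ker: "\<alpha> - ?p \<alpha> \<in> span I" if "\<alpha> \<in> R" for \<alpha>
    using diff_quot_proj_mem_span[OF V IV] that RV by blast
  have p_orth: "?p \<alpha> \<bullet> w = 0" if "w \<in> span I" for \<alpha> w
    using quot_space_orth[OF quot_proj_mem[OF V] that] .
  have inner_split: "\<alpha> \<bullet> \<beta> = ?p \<alpha> \<bullet> ?p \<beta> + (\<alpha> - ?p \<alpha>) \<bullet> (\<beta> - ?p \<beta>)" if "\<alpha> \<in> R" "\<beta> \<in> R" for \<alpha> \<beta>
  proof -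
    have "?p \<alpha> \<bullet> (\<beta> - ?p \<beta>) = 0" "?p \<beta> \<bullet> (\<alpha> - ?p \<alpha>) = 0" using p_orth ker that by blast+
    then show ?thesis by (simp add: inner_diff_left inner_diff_right inner_commute)
  qed
  have balanced: "\<exists>\<alpha>'\<in>R. \<exists>\<beta>'\<in>R. ?p \<alpha>' = ?p \<alpha> \<and> ?p \<beta>' = ?p \<beta> \<and> \<alpha>' \<bullet> \<beta>' > ?p \<alpha> \<bullet> ?p \<beta>"
    if \<alpha>: "\<alpha> \<in> R" and \<beta>: "\<beta> \<in> R" and neg: "\<alpha> \<bullet> \<beta> < ?p \<alpha> \<bullet> ?p \<beta>" for \<alpha> \<beta>
  proof -
    have "(\<alpha> - ?p \<alpha>) \<bullet> (\<beta> - ?p \<beta>) < 0" using inner_split[OF \<alpha> \<beta>] neg by simp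
    then obtain \<alpha>' \<beta>' where *: "\<alpha>' \<in> R" "\<beta>' \<in> R" "\<alpha>' - ?p \<alpha> \<in> span I" "\<beta>' - ?p \<beta> \<in> span I"
        "(\<alpha>' - ?p \<alpha>) \<bullet> (\<beta>' - ?p \<beta>) > 0"
      using fibres_balanced[OF grs IR indep obtuse \<alpha> ker[OF \<alpha>] p_orth[OF span_base]
          \<beta> ker[OF \<beta>] p_orth[OF span_base]] by blast
    have "?p \<alpha>' = ?p \<alpha>" "?p \<beta>' = ?p \<beta>"
      using * by (auto intro!: quot_proj_eqI[OF V] quot_proj_mem[OF V])
    then show ?thesis using * inner_split[of \<alpha>' \<beta>'] by force
  qed
  have lift_diff: "\<exists>\<alpha>'\<in>R. \<exists>\<beta>'\<in>R. ?p \<alpha>' = ?p \<alpha> \<and> ?p \<beta>' = ?p \<beta> \<and> \<alpha>' - \<beta>' \<in> R"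
    if \<alpha>: "\<alpha> \<in> R" and \<beta>: "\<beta> \<in> R" and pos: "?p \<alpha> \<bullet> ?p \<beta> > 0" for \<alpha> \<beta>
  proof (cases "\<alpha> \<bullet> \<beta> > 0")
    case True
    then show ?thesis using grs_diff_mem[OF grs \<alpha> \<beta>] \<alpha> \<beta> by blast
  next
    case False
    then obtain \<alpha>' \<beta>' where *: "\<alpha>' \<in> R" "\<beta>' \<in> R" "?p \<alpha>' = ?p \<alpha>" "?p \<beta>' = ?p \<beta>"
        "\<alpha>' \<bullet> \<beta>' > ?p \<alpha> \<bullet> ?p \<beta>"
      using balanced[OF \<alpha> \<beta>] pos by auto
    then show ?thesis using grs_diff_mem[OF grs *(1,2)] pos by force
  qed
  have diff: "?p \<alpha> - ?p \<beta> \<in> ?p ` R" if "\<alpha> \<in> R" "\<beta> \<in> R" "?p \<alpha> \<bullet> ?p \<beta> > 0" for \<alpha> \<beta>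
    using lift_diff[OF that] linear_diff[OF lin] by (metis imageI)
  have p_minus: "?p (- \<beta>) = - ?p \<beta>" for \<beta> by (rule linear_neg[OF lin])
  have uminus: "- \<beta> \<in> R" if "\<beta> \<in> R" for \<beta> using grs_uminus_mem[OF grs that] .
  have add: "?p \<alpha> + ?p \<beta> \<in> ?p ` R" if "\<alpha> \<in> R" "\<beta> \<in> R" "?p \<alpha> \<bullet> ?p \<beta> < 0" for \<alpha> \<beta>
    using diff[of \<alpha> "- \<beta>"] that uminus by (simp add: p_minus)
  have orth: "?p \<alpha> - ?p \<beta> \<in> ?p ` R"
    if \<alpha>: "\<alpha> \<in> R" and \<beta>: "\<beta> \<in> R" and zero: "?p \<alpha> \<bullet> ?p \<beta> = 0"
      and sum: "?p \<alpha> + ?p \<beta> \<in> ?p ` R" for \<alpha> \<beta>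
  proof (cases "?p \<alpha> = 0")
    case True
    then show ?thesis using uminus[OF \<beta>] by (auto simp flip: p_minus)
  next
    case False
    obtain \<gamma> where \<gamma>: "\<gamma> \<in> R" "?p \<gamma> = ?p \<alpha> + ?p \<beta>" using sum by force
    \<comment> \<open>As the projection of \<open>\<gamma>\<close> pairs positively with that of \<open>\<alpha>\<close>, the given sum lifts to a
      sum of roots within the two fibres.\<close>
    have "?p \<gamma> \<bullet> ?p \<alpha> > 0" using False zero
      by (simp add: \<gamma>(2) inner_add_left inner_add_right inner_commute)
    then obtain \<gamma>' \<alpha>' where *: "\<gamma>' \<in> R" "\<alpha>' \<in> R" "?p \<gamma>' = ?p \<gamma>" "?p \<alpha>' = ?p \<alpha>" "\<gamma>' - \<alpha>' \<in> R"
      using lift_diff[OF \<gamma>(1) \<alpha>] by blast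
    define \<beta>' where "\<beta>' = \<gamma>' - \<alpha>'"
    have \<beta>': "\<beta>' \<in> R" "\<alpha>' + \<beta>' \<in> R" "?p \<beta>' = ?p \<beta>"
      using * \<gamma>(2) by (auto simp: \<beta>'_def linear_diff[OF lin])
    have "\<exists>\<alpha>''\<in>R. \<exists>\<beta>''\<in>R. ?p \<alpha>'' = ?p \<alpha> \<and> ?p \<beta>'' = ?p \<beta> \<and> \<alpha>'' - \<beta>'' \<in> R"
    proof (cases "\<alpha>' \<bullet> \<beta>' < 0")
      case True
      then obtain \<alpha>'' \<beta>'' where "\<alpha>'' \<in> R" "\<beta>'' \<in> R" "?p \<alpha>'' = ?p \<alpha>" "?p \<beta>'' = ?p \<beta>" "\<alpha>'' \<bullet> \<beta>'' > 0"
        using balanced[OF *(2) \<beta>'(1)] * \<beta>' zero by auto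
      then show ?thesis using grs_diff_mem[OF grs] by blast
    next
      case False
      then have "\<alpha>' - \<beta>' \<in> R"
        using grs_diff_mem[OF grs *(2) \<beta>'(1)] grs_orthogonal_mem_iff[OF grs *(2) \<beta>'(1)] \<beta>'(2)
        by (cases "\<alpha>' \<bullet> \<beta>' = 0") auto
      then show ?thesis using * \<beta>' by blast
    qed
    then show ?thesis using linear_diff[OF lin] by (metis imageI)
  qed
  have orth_iff: "?p \<alpha> + ?p \<beta> \<in> ?p ` R \<longleftrightarrow> ?p \<alpha> - ?p \<beta> \<in> ?p ` R"
    if "\<alpha> \<in> R" "\<beta> \<in> R" "?p \<alpha> \<bullet> ?p \<beta> = 0" for \<alpha> \<beta>
    using orth[OF that] orth[of \<alpha> "- \<beta>"] that uminus by (auto simp: p_minus)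
  have span: "quot_space V I = span (?p ` R)"
    using linear_span_image[OF lin, of R] quot_proj_image[OF V] VR by simp
  have ne: "?p ` R \<noteq> {}" using grs_zero_mem[OF grs] by blast
  have sub: "?p ` R \<subseteq> quot_space V I" using quot_proj_mem[OF V] by blast
  have axioms: "\<forall>a\<in>?p ` R. \<forall>b\<in>?p ` R. (a \<bullet> b < 0 \<longrightarrow> a + b \<in> ?p ` R) \<and>
      (a \<bullet> b > 0 \<longrightarrow> a - b \<in> ?p ` R) \<and> (a \<bullet> b = 0 \<longrightarrow> (a + b \<in> ?p ` R \<longleftrightarrow> a - b \<in> ?p ` R))"
    using add diff orth_iff by (simp only: ball_simps) blast
  show ?thesis
    unfolding generalized_root_system_def quot_roots_def
    using subspace_quot_space[OF V] sub ne finite_imageI[OF fin] span axioms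
    by (intro conjI) assumption+
qed

lemma quot_is_base:
  assumes grs: "generalized_root_system R V" and base: "is_base S R V" and "I \<subseteq> S"
  shows "is_base (quot_base S V I) (quot_roots R V I) (quot_space V I)"
proof -
  let ?p = "quot_proj V I"
  have V: "subspace V" and RV: "R \<subseteq> V" using grs by (auto simp: generalized_root_system_def)
  have SR: "S \<subseteq> R" by (rule base_subset[OF base])
  have IV: "I \<subseteq> V" using SR RV \<open>I \<subseteq> S\<close> by blast
  have indep: "independent S" by (rule base_independent[OF base])
  have finS: "finite S" by (rule base_finite[OF base])
  have spanS: "span S = V" using base by (simp add: is_base_def)
  note lin = linear_quot_proj[OF V, of I]
  have p_I: "?p i = 0" if "i \<in> I" for i using quot_proj_eq_zero[OF V span_base[OF that]] .
  have inj: "inj_on ?p (span (S - I))"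
  proof (rule inj_onI)
    fix x y assume xy: "x \<in> span (S - I)" "y \<in> span (S - I)" "?p x = ?p y"
    then have d: "x - y \<in> span (S - I)" by (intro span_diff)
    then have "x - y \<in> V" using span_mono[of "S - I" S] spanS by blast
    then have "x - y \<in> span I"
      using diff_quot_proj_mem_span[OF V IV, of "x - y"] xy(3) by (simp add: linear_diff[OF lin])
    then have "x - y = 0" by (rule span_Int_span_Diff[OF indep \<open>I \<subseteq> S\<close> _ d])
    then show "x = y" by simp
  qed
  have indep_diff: "independent (S - I)" using independent_mono[OF indep] by blast
  have indep_im: "independent (?p ` (S - I))"
    by (rule linear_independent_injective_image[OF lin indep_diff inj])
  have inj_S: "inj_on ?p (S - I)"
    using inj_on_subset[OF inj span_superset] .
  have B: "quot_base S V I = ?p ` (S - I)"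
  proof -
    have "0 \<notin> ?p ` (S - I)" using indep_im dependent_zero by metis
    moreover have "?p ` I \<subseteq> {0}" using p_I by blast
    moreover have "?p ` S = ?p ` (S - I) \<union> ?p ` I" using \<open>I \<subseteq> S\<close> by blast
    ultimately show ?thesis unfolding quot_base_def by blast
  qed
  have "span (quot_base S V I) = span (?p ` S)"
    unfolding quot_base_def by (rule span_delete_0)
  also have "\<dots> = quot_space V I"
    by (simp add: linear_span_image[OF lin] spanS quot_proj_image[OF V])
  finally have span_B: "span (quot_base S V I) = quot_space V I" .
  have coords: "\<exists>m :: 'a \<Rightarrow> int. ?p \<beta> = (\<Sum>\<alpha>\<in>?p ` (S - I). of_int (m \<alpha>) *\<^sub>R \<alpha>) \<and>
      ((\<forall>\<alpha>\<in>?p ` (S - I). m \<alpha> \<ge> 0) \<or> (\<forall>\<alpha>\<in>?p ` (S - I). m \<alpha> \<le> 0))" if "\<beta> \<in> R" for \<beta>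
  proof -
    obtain m :: "'a \<Rightarrow> int" where m: "\<beta> = (\<Sum>\<alpha>\<in>S. of_int (m \<alpha>) *\<^sub>R \<alpha>)"
      and sgn: "(\<forall>\<alpha>\<in>S. m \<alpha> \<ge> 0) \<or> (\<forall>\<alpha>\<in>S. m \<alpha> \<le> 0)"
      by (rule base_coords[OF base \<open>\<beta> \<in> R\<close>])
    define m' where "m' = m \<circ> inv_into (S - I) ?p"
    have m': "m' (?p \<alpha>) = m \<alpha>" if "\<alpha> \<in> S - I" for \<alpha>
      using inv_into_f_f[OF inj_S that] by (simp add: m'_def)
    have "?p \<beta> = (\<Sum>\<alpha>\<in>S. of_int (m \<alpha>) *\<^sub>R ?p \<alpha>)"
      by (simp add: m linear_sum[OF lin] linear_scale[OF lin])
    also have "\<dots> = (\<Sum>\<alpha>\<in>S - I. of_int (m \<alpha>) *\<^sub>R ?p \<alpha>)"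
      using finS p_I by (intro sum.mono_neutral_right) auto
    also have "\<dots> = (\<Sum>\<alpha>\<in>?p ` (S - I). of_int (m' \<alpha>) *\<^sub>R \<alpha>)"
      using m' by (simp add: sum.reindex[OF inj_S])
    finally have "?p \<beta> = (\<Sum>\<alpha>\<in>?p ` (S - I). of_int (m' \<alpha>) *\<^sub>R \<alpha>)" .
    moreover have "(\<forall>\<alpha>\<in>?p ` (S - I). m' \<alpha> \<ge> 0) \<or> (\<forall>\<alpha>\<in>?p ` (S - I). m' \<alpha> \<le> 0)"
      using sgn m' by auto
    ultimately show ?thesis by (intro exI[of _ m'] conjI)
  qed
  have "?p ` (S - I) \<subseteq> ?p ` R" using SR by blast
  then show ?thesis
    using coords indep_im span_B unfolding is_base_def quot_roots_def B by simp
qed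

theorem theorem3p1:
  fixes R V S I :: "'a::euclidean_space set"
  assumes "generalized_root_system R V"
    and "is_base S R V"
    and "I \<subseteq> S"
  shows "generalized_root_system (quot_roots R V I) (quot_space V I) \<and>
         is_base (quot_base S V I) (quot_roots R V I) (quot_space V I)"
  using quot_is_grs[OF assms] quot_is_base[OF assms] ..

end
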